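(* Let $G$ be a connected graph with bounded degree, either oriented (each edge is given one fixed orientation) or unoriented, with a fixed origin $o\in V(G)$, and suppose that $p_c^{\mathrm b}(G)<1$. Then $$p_c^{\mathrm b}(G\times\mathbb{Z}_+)<p_c^{\mathrm b}(G),$$ where $G\times\mathbb{Z}_+$ is the ladder graph of $G$, with origin $(o,0)$.
   Context: $\mathbb{Z}_+=\{0,1,2,\dots\}$. Connectedness and degree of an oriented graph refer to the underlying unoriented graph. Ladder graph: $G\times\mathbb{Z}_+$ has vertex set $V(G)\times\mathbb{Z}_+$ and two types of edges: horizontal edges from $(v,n)$ to $(u,n)$ for each edge $vu\in E(G)$ and $n\in\mathbb{Z}_+$, with the same orientation as $vu$ if $G$ is oriented and unoriented if $G$ is unoriented; and vertical edges from $(v,n)$ to $(v,n+1)$ for $v\in V(G)$, $n\in\mathbb{Z}_+$, always oriented upwards. Bernoulli bond percolation with parameter $p\in[0,1]$ on a graph: every edge is independently open with probability $p$ and closed with probability $1-p$; $\mathbb{P}_p$ denotes the law. For a vertex $v_0$, $\{v_0\to\infty\}$ is the event that there is an infinite sequence of distinct vertices $v_0,v_1,v_2,\dots$ such that each $\langle v_{n-1},v_n\rangle$, $n\ge1$, is an open edge of the graph (oriented edges are traversed only in the direction of their orientation, unoriented edges in either direction). For a graph $G$ with fixed origin $o$, $p_c^{\mathrm b}(G)=\inf\{p:\ \mathbb{P}_p(o\to\infty)>0\}$. *)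

theory Defs
  imports "HOL-Probability.Probability" "HOL-Library.Uprod"
begin

text \<open>Graphs in which every edge is individually either unoriented or oriented: the ladder of
  an unoriented graph has edges of both kinds. \<^term>\<open>Oriented u v\<close> points from \<open>u\<close> to \<open>v\<close>.\<close>

datatype (ends: 'v) edge = Unoriented "'v uprod" | Oriented 'v 'v

record 'v graph =
  verts :: "'v set"
  edges :: "'v edge set"

text \<open>Injectivity of \<^const>\<open>ends\<close> says that the underlying unoriented graph has no multiple
  edges; in particular an oriented graph contains at most one of the edges from \<open>u\<close> to \<open>v\<close>
  and from \<open>v\<close> to \<open>u\<close>.\<close>

definition simple_graph :: "'v graph \<Rightarrow> bool" where
  "simple_graph G \<longleftrightarrow>
     (\<forall>e\<in>edges G. ends e \<subseteq> verts G \<and> card (ends e) = 2) \<and> inj_on ends (edges G)"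

definition unoriented_graph :: "'v graph \<Rightarrow> bool" where
  "unoriented_graph G \<longleftrightarrow> (\<forall>e\<in>edges G. \<exists>s. e = Unoriented s)"

definition oriented_graph :: "'v graph \<Rightarrow> bool" where
  "oriented_graph G \<longleftrightarrow> (\<forall>e\<in>edges G. \<exists>u v. e = Oriented u v)"

definition adjacency :: "'v graph \<Rightarrow> ('v \<times> 'v) set" where
  "adjacency G = {(u, v). \<exists>e\<in>edges G. ends e = {u, v}}"

definition connected_graph :: "'v graph \<Rightarrow> bool" where
  "connected_graph G \<longleftrightarrow> (\<forall>u\<in>verts G. \<forall>v\<in>verts G. (u, v) \<in> (adjacency G)\<^sup>*)"

definition bounded_degree :: "'v graph \<Rightarrow> bool" where
  "bounded_degree G \<longleftrightarrow>
     (\<exists>D. \<forall>v\<in>verts G. finite {e \<in> edges G. v \<in> ends e} \<and> card {e \<in> edges G. v \<in> ends e} \<le> D)"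

definition ladder :: "'v graph \<Rightarrow> ('v \<times> nat) graph" where
  "ladder G =
     \<lparr>verts = verts G \<times> UNIV,
      edges = {map_edge (\<lambda>v. (v, n)) e | e n. e \<in> edges G}
            \<union> {Oriented (v, n) (v, Suc n) | v n. v \<in> verts G}\<rparr>"

fun traverses :: "'v edge \<Rightarrow> 'v \<Rightarrow> 'v \<Rightarrow> bool" where
  "traverses (Unoriented s) u v \<longleftrightarrow> s = Upair u v"
| "traverses (Oriented a b) u v \<longleftrightarrow> a = u \<and> b = v"

definition bond_percolation :: "'v graph \<Rightarrow> real \<Rightarrow> ('v edge \<Rightarrow> bool) measure" where
  "bond_percolation G p = (\<Pi>\<^sub>M e\<in>edges G. measure_pmf (bernoulli_pmf p))"

definition percolates :: "'v graph \<Rightarrow> 'v \<Rightarrow> ('v edge \<Rightarrow> bool) \<Rightarrow> bool" where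
  "percolates G v\<^sub>0 \<omega> \<longleftrightarrow>
     (\<exists>f :: nat \<Rightarrow> 'v. f 0 = v\<^sub>0 \<and> inj f \<and>
        (\<forall>n. \<exists>e\<in>edges G. \<omega> e \<and> traverses e (f n) (f (Suc n))))"

text \<open>On locally finite graphs the event below is measurable, by Koenig's lemma.\<close>

definition percolation_prob :: "'v graph \<Rightarrow> 'v \<Rightarrow> real \<Rightarrow> real" where
  "percolation_prob G v\<^sub>0 p =
     measure (bond_percolation G p) {\<omega> \<in> space (bond_percolation G p). percolates G v\<^sub>0 \<omega>}"

text \<open>The infimum is taken in the extended reals, where the infimum of the empty set is
  \<open>\<infinity>\<close>: a graph without percolation at any \<open>p\<close> does not have critical value below 1.\<close>

definition critical_prob :: "'v graph \<Rightarrow> 'v \<Rightarrow> ereal" where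
  "critical_prob G v\<^sub>0 = Inf (ereal ` {p \<in> {0..1}. percolation_prob G v\<^sub>0 p > 0})"

end

theory Submission
  imports Defs
begin

text \<open>Compare the ladder at some \<open>p < p\<^sub>c(G)\<close> with \<open>G\<close> at a slightly larger parameter \<open>q\<close>, exploring
  both clusters vertex by vertex. When the exploration reaches a vertex \<open>v\<close> of \<open>G\<close>, in the ladder
  at height \<open>m\<close>, each yet unexplored edge out of \<open>v\<close> may be crossed at height \<open>m\<close> and, if the single
  vertical edge from \<open>(v, m)\<close> to \<open>(v, m + 1)\<close> is open, also at height \<open>m + 1\<close>; after that the whole
  fibre over \<open>v\<close> is discarded, so all edges inspected are fresh. The edges that can be
  crossed form a mixture of product measures: density \<open>1 - (1 - p)\<^sup>2\<close> with
  probability \<open>p\<close>, and density \<open>p\<close> otherwise. With at most \<open>D\<close> edges at each vertex this mixture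
  dominates the product measure of density \<open>q\<close> whenever \<open>q \<le> p + p\<^sup>2 (1 - p)\<^bsup>D + 1\<^esup>\<close>. The right-hand
  side is continuous in \<open>p\<close> and exceeds \<open>p\<^sub>c(G)\<close> at \<open>p = p\<^sub>c(G)\<close>, because
  \<open>0 < p\<^sub>c(G) < 1\<close>, hence also at some \<open>p < p\<^sub>c(G)\<close>.\<close>

section \<open>Random subsets\<close>

text \<open>Expectation of \<open>f Y\<close> when \<open>Y\<close> keeps each element of
  \<open>S\<close> independently with probability \<open>p\<close>. As a finite sum it allows
  densities to be compared by algebra and induction on \<open>S\<close>, away from product
  measures.\<close>

definition thinned_mean :: "real \<Rightarrow> 'a set \<Rightarrow> ('a set \<Rightarrow> real) \<Rightarrow> real" where
  "thinned_mean p S f = (\<Sum>Y\<in>Pow S. p ^ card Y * (1 - p) ^ card (S - Y) * f Y)"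

lemma thinned_mean_empty [simp]: "thinned_mean p {} f = f {}"
  by (simp add: thinned_mean_def)

lemma thinned_mean_insert:
  assumes "finite S" "x \<notin> S"
  shows "thinned_mean p (insert x S) f =
    p * thinned_mean p S (\<lambda>Y. f (insert x Y)) + (1 - p) * thinned_mean p S f"
proof -
  have disj: "Pow S \<inter> insert x ` Pow S = {}" using assms by auto
  have inj: "inj_on (insert x) (Pow S)"
    using assms by (auto simp: inj_on_def)
  have "thinned_mean p (insert x S) f =
    (\<Sum>Y\<in>Pow S. p ^ card Y * (1 - p) ^ card (insert x S - Y) * f Y) +
    (\<Sum>Y\<in>Pow S. p ^ card (insert x Y) * (1 - p) ^ card (insert x S - insert x Y) * f (insert x Y))"
    unfolding thinned_mean_def Pow_insert
    using assms disj by (subst sum.union_disjoint) (auto simp: sum.reindex[OF inj])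
  also have "(\<Sum>Y\<in>Pow S. p ^ card Y * (1 - p) ^ card (insert x S - Y) * f Y) =
    (1 - p) * thinned_mean p S f"
    unfolding thinned_mean_def sum_distrib_left
  proof (rule sum.cong)
    fix Y assume "Y \<in> Pow S"
    then have "insert x S - Y = insert x (S - Y)" "x \<notin> S - Y" "finite (S - Y)"
      using assms by auto
    then show "p ^ card Y * (1 - p) ^ card (insert x S - Y) * f Y =
      (1 - p) * (p ^ card Y * (1 - p) ^ card (S - Y) * f Y)" by simp
  qed simp
  also have "(\<Sum>Y\<in>Pow S. p ^ card (insert x Y) * (1 - p) ^ card (insert x S - insert x Y) * f (insert x Y)) =
    p * thinned_mean p S (\<lambda>Y. f (insert x Y))"
    unfolding thinned_mean_def sum_distrib_left
  proof (rule sum.cong)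
    fix Y assume "Y \<in> Pow S"
    then have "insert x S - insert x Y = S - Y" "x \<notin> Y" "finite Y"
      using assms by (auto intro: finite_subset)
    then show "p ^ card (insert x Y) * (1 - p) ^ card (insert x S - insert x Y) * f (insert x Y) =
      p * (p ^ card Y * (1 - p) ^ card (S - Y) * f (insert x Y))" by simp
  qed simp
  finally show ?thesis by simp
qed

lemma thinned_mean_cong:
  "(\<And>Y. Y \<subseteq> S \<Longrightarrow> f Y = g Y) \<Longrightarrow> thinned_mean p S f = thinned_mean p S g"
  by (simp add: thinned_mean_def)

lemma thinned_mean_const:
  assumes "finite S"
  shows "thinned_mean p S (\<lambda>_. c) = c"
  using assms by (induction rule: finite_induct) (simp_all add: thinned_mean_insert algebra_simps)

lemma thinned_mean_linear:
  "thinned_mean p S (\<lambda>Y. a * f Y + b * g Y) = a * thinned_mean p S f + b * thinned_mean p S g"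
  by (simp add: thinned_mean_def sum_distrib_left sum.distrib[symmetric] algebra_simps)

lemma thinned_mean_mono:
  assumes "0 \<le> p" "p \<le> 1" "\<And>Y. Y \<subseteq> S \<Longrightarrow> f Y \<le> g Y"
  shows "thinned_mean p S f \<le> thinned_mean p S g"
  unfolding thinned_mean_def using assms by (intro sum_mono mult_left_mono) auto

lemma thinned_mean_union:
  assumes "finite S" "finite T" "S \<inter> T = {}"
  shows "thinned_mean p (S \<union> T) f = thinned_mean p S (\<lambda>Y. thinned_mean p T (\<lambda>Z. f (Y \<union> Z)))"
  using assms(1,3)
proof (induction S arbitrary: f rule: finite_induct)
  case (insert x S)
  then show ?case
    using assms(2) by (simp add: thinned_mean_insert)
qed simp

lemma thinned_mean_image:
  assumes "finite S" "inj_on h S"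
  shows "thinned_mean p (h ` S) f = thinned_mean p S (\<lambda>Y. f (h ` Y))"
  using assms
proof (induction S arbitrary: f rule: finite_induct)
  case (insert x S)
  then show ?case by (simp add: thinned_mean_insert)
qed simp

text \<open>An element misses both of two independent thinnings with probability
  \<open>(1 - p)\<^sup>2\<close>, independently of the other elements. Used for edges that may be
  crossed at either of two heights.\<close>

lemma thinned_mean_superpose:
  assumes "finite S"
  shows "thinned_mean p S (\<lambda>Y. thinned_mean p S (\<lambda>Z. f (Y \<union> Z))) =
    thinned_mean (1 - (1 - p)\<^sup>2) S f"
  using assms
proof (induction S arbitrary: f rule: finite_induct)
  case (insert x S)
  have eq: "insert x Y \<union> Z = insert x (Y \<union> Z)" "Y \<union> insert x Z = insert x (Y \<union> Z)" for Y Z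
    by auto
  show ?case
    using insert.hyps insert.IH[of f] insert.IH[of "\<lambda>Y. f (insert x Y)"]
    by (simp add: thinned_mean_insert thinned_mean_linear eq)
      (simp add: algebra_simps power2_eq_square)
qed simp

text \<open>The mixture is an exchangeable field in which, whatever has been seen of the other elements,
  the conditional weight of the dense component stays at least \<^term>\<open>a * (1 - p) ^ card S\<close>; each step
  of the induction reveals one element and updates \<^term>\<open>a\<close> by Bayes' rule.\<close>

lemma thinned_mean_le_mixture:
  fixes f :: "'a set \<Rightarrow> real"
  assumes "finite S" "0 < p" "p < 1" "0 \<le> q" "q \<le> 1" "0 \<le> a" "a \<le> 1"
    and "q \<le> p + a * (1 - p) ^ Suc (card S) * p"
    and "\<And>Y Z. Y \<subseteq> Z \<Longrightarrow> Z \<subseteq> S \<Longrightarrow> f Y \<le> f Z"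
  shows "thinned_mean q S f \<le>
    a * thinned_mean (1 - (1 - p)\<^sup>2) S f + (1 - a) * thinned_mean p S f"
  using assms(1,6-)
proof (induction S arbitrary: f a rule: finite_induct)
  case empty
  then show ?case by (simp add: algebra_simps)
next
  case (insert x S)
  define r where "r = 1 - (1 - p)\<^sup>2"
  define b where "b = p + a * p * (1 - p)"
  let ?f1 = "\<lambda>Y. f (insert x Y)"
  have r: "r = p + p * (1 - p)" by (simp add: r_def power2_eq_square algebra_simps)
  have "a * p \<le> p"
    using insert assms mult_right_mono[of a 1 p] by simp
  then have ap: "a * p < 1" using assms by linarith
  have "p \<le> b" unfolding b_def using assms insert by simp
  then have b0: "0 < b" using assms by linarith
  have b1: "1 - b = (1 - p) * (1 - a * p)" by (simp add: b_def algebra_simps)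
  have b1': "0 < 1 - b" unfolding b1 using assms ap by simp
  have b_mix: "b = a * r + (1 - a) * p" by (simp add: b_def r algebra_simps)
  \<comment> \<open>Passing from \<open>insert x S\<close> to \<open>S\<close> frees one factor
    \<open>1 - p\<close>; it pays for the weight that the dense component may lose when
    \<open>x\<close> is revealed.\<close>
  have pw: "(1 - p) ^ Suc (card (insert x S)) = (1 - p) * (1 - p) ^ Suc (card S)"
    using insert by simp
  have pow: "0 \<le> (1 - p) ^ Suc (card S)" "(1 - p) ^ Suc (card S) \<le> 1"
    using assms by (auto intro: power_le_one simp del: power_Suc)
  have q: "q \<le> p + (a * (1 - p)) * (1 - p) ^ Suc (card S) * p"
    using insert.prems(3) unfolding pw by (simp add: mult.assoc)
  have "(a * (1 - p)) * (1 - p) ^ Suc (card S) * p \<le> (a * (1 - p)) * 1 * p"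
    using pow insert.prems assms by (intro mult_right_mono mult_left_mono) auto
  then have qb: "q \<le> b" using q by (simp add: b_def algebra_simps)
  \<comment> \<open>Posterior weights of the dense component, given that \<open>x\<close> is present
    (\<open>a1\<close>) or absent (\<open>a0\<close>). Presence does not lower the weight, and
    absence costs at most a factor \<open>1 - p\<close>, so \<open>a * (1 - p)\<close> bounds both
    from below.\<close>
  define a1 where "a1 = a * r / b"
  define a0 where "a0 = a * (1 - r) / (1 - b)"
  have r1: "1 - r = (1 - p) * (1 - p)" by (simp add: r_def power2_eq_square)
  have a0': "a0 = a * (1 - p) / (1 - a * p)"
    unfolding a0_def b1 r1 using assms by simp
  have "b \<le> r" unfolding b_def r
    using insert.prems assms mult_right_mono[of a 1 "p * (1 - p)"] by (simp add: mult.assoc)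
  then have "a * b \<le> a * r" using insert.prems by (intro mult_left_mono)
  then have a1_ge: "a \<le> a1" unfolding a1_def using b0 by (simp add: field_simps)
  have "0 \<le> (1 - a) * p" using insert.prems assms by simp
  then have a1_le: "a1 \<le> 1" unfolding a1_def using b0 b_mix by (simp add: field_simps)
  have "a * (1 - p) * (1 - a * p) \<le> a * (1 - p) * 1"
    using insert.prems assms by (intro mult_left_mono) auto
  then have a0_ge: "a * (1 - p) \<le> a0" unfolding a0' using ap by (simp add: pos_le_divide_eq)
  have a0_le: "a0 \<le> 1" unfolding a0' using ap insert.prems by (simp add: field_simps)
  have a1p: "a * (1 - p) \<le> a1"
    using a1_ge insert.prems assms mult_left_mono[of "1 - p" 1 a] by simp
  have ge0: "0 \<le> a * (1 - p)" using insert.prems assms by simp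
  have IH: "thinned_mean q S g \<le> c * thinned_mean r S g + (1 - c) * thinned_mean p S g"
    if "a * (1 - p) \<le> c" "c \<le> 1" and mono: "\<And>Y Z. Y \<subseteq> Z \<Longrightarrow> Z \<subseteq> S \<Longrightarrow> g Y \<le> g Z" for g c
  proof -
    have "(a * (1 - p)) * (1 - p) ^ Suc (card S) * p \<le> c * (1 - p) ^ Suc (card S) * p"
      using that pow assms by (intro mult_right_mono) auto
    then show ?thesis
      unfolding r_def using that ge0 q by (intro insert.IH mono) auto
  qed
  have m1: "thinned_mean q S ?f1 \<le> a1 * thinned_mean r S ?f1 + (1 - a1) * thinned_mean p S ?f1"
    by (rule IH[OF a1p a1_le]) (use insert.prems in \<open>auto intro!: insert.prems(4)\<close>)
  have m0: "thinned_mean q S f \<le> a0 * thinned_mean r S f + (1 - a0) * thinned_mean p S f"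
    by (rule IH[OF a0_ge a0_le]) (use insert.prems in \<open>auto intro!: insert.prems(4)\<close>)
  have le: "thinned_mean q S f \<le> thinned_mean q S ?f1"
    using assms by (intro thinned_mean_mono) (auto intro!: insert.prems(4))
  have "thinned_mean q (insert x S) f = thinned_mean q S f + q * (thinned_mean q S ?f1 - thinned_mean q S f)"
    using insert by (simp add: thinned_mean_insert algebra_simps)
  \<comment> \<open>Raising the density at \<open>x\<close> from \<open>q\<close> to
    \<open>b\<close> cannot decrease the mean, since \<open>f\<close> is monotone.\<close>
  also have "\<dots> \<le> thinned_mean q S f + b * (thinned_mean q S ?f1 - thinned_mean q S f)"
    using qb le by (intro add_left_mono mult_right_mono) auto
  also have "\<dots> = b * thinned_mean q S ?f1 + (1 - b) * thinned_mean q S f"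
    by (simp add: algebra_simps)
  also have "\<dots> \<le> b * (a1 * thinned_mean r S ?f1 + (1 - a1) * thinned_mean p S ?f1) +
      (1 - b) * (a0 * thinned_mean r S f + (1 - a0) * thinned_mean p S f)"
    using m1 m0 b0 b1' by (intro add_mono mult_left_mono) auto
  also have "\<dots> = (b * a1) * thinned_mean r S ?f1 + (b - b * a1) * thinned_mean p S ?f1 +
      ((1 - b) * a0) * thinned_mean r S f + ((1 - b) - (1 - b) * a0) * thinned_mean p S f"
    by (simp add: algebra_simps)
  \<comment> \<open>Probability of the state of \<open>x\<close> times posterior weight is a joint
    weight, so the four terms reassemble into the two components over
    \<open>insert x S\<close>.\<close>
  also have "b * a1 = a * r" using b0 by (simp add: a1_def)
  also have "(1 - b) * a0 = a * (1 - r)" using b1' by (simp add: a0_def)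
  also have "b - a * r = (1 - a) * p" using b_mix by simp
  also have "(1 - b) - a * (1 - r) = (1 - a) * (1 - p)" using b_mix by (simp add: algebra_simps)
  finally show ?case
    using insert.hyps by (simp add: thinned_mean_insert r_def[symmetric] algebra_simps)
qed

section \<open>Product Bernoulli measures and the exploration identity\<close>

abbreviation bernoulli_field :: "'a set \<Rightarrow> real \<Rightarrow> ('a \<Rightarrow> bool) measure" where
  "bernoulli_field I p \<equiv> \<Pi>\<^sub>M i\<in>I. measure_pmf (bernoulli_pmf p)"

lemma prob_space_bernoulli_field: "prob_space (bernoulli_field I p)"
  by (intro prob_space_PiM measure_pmf.prob_space_axioms)

text \<open>The joint law of the coordinates is the product of their marginals, which characterises
  independence; the empty index set is checked from the definition.\<close>

lemma indep_coordinates: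
  "prob_space.indep_vars (bernoulli_field I p) (\<lambda>_. measure_pmf (bernoulli_pmf p)) (\<lambda>i \<omega>. \<omega> i) I"
proof -
  interpret P: product_prob_space "\<lambda>_. measure_pmf (bernoulli_pmf p)" I ..
  show ?thesis
  proof (cases "I = {}")
    case True
    show ?thesis unfolding P.indep_vars_def P.indep_sets_def using True by auto
  next
    case False
    have "distr (bernoulli_field I p) (bernoulli_field I p) (\<lambda>\<omega>. restrict \<omega> I) =
        distr (bernoulli_field I p) (bernoulli_field I p) (\<lambda>\<omega>. \<omega>)"
      by (rule distr_cong) (auto simp: space_PiM)
    also have "\<dots> = bernoulli_field I p" by (rule distr_id)
    finally show ?thesis
      by (subst P.indep_vars_iff_distr_eq_PiM'[OF False]) (auto intro!: PiM_cong simp: P.PiM_component)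
  qed
qed

lemma prob_open_set:
  assumes "finite F" "F \<subseteq> I" "Y \<subseteq> F" "0 \<le> p" "p \<le> 1"
  shows "measure (bernoulli_field I p) {\<omega> \<in> space (bernoulli_field I p). {i\<in>F. \<omega> i} = Y} =
    p ^ card Y * (1 - p) ^ card (F - Y)"
proof -
  interpret P: product_prob_space "\<lambda>_. measure_pmf (bernoulli_pmf p)" I ..
  have "{\<omega> \<in> space (bernoulli_field I p). {i\<in>F. \<omega> i} = Y} =
      prod_emb I (\<lambda>_. measure_pmf (bernoulli_pmf p)) F (\<Pi>\<^sub>E i\<in>F. {i \<in> Y})"
    using assms(2,3) by (auto simp: prod_emb_def space_PiM PiE_iff extensional_def)
  then have "measure (bernoulli_field I p) {\<omega> \<in> space (bernoulli_field I p). {i\<in>F. \<omega> i} = Y} =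
      (\<Prod>i\<in>F. measure (measure_pmf (bernoulli_pmf p)) {i \<in> Y})"
    using assms by (simp add: P.measure_PiM_emb)
  also have "\<dots> = (\<Prod>i\<in>F. if i \<in> Y then p else 1 - p)"
    using assms by (intro prod.cong) (auto simp: measure_pmf_single)
  also have "\<dots> = (\<Prod>i\<in>Y. p) * (\<Prod>i\<in>F - Y. 1 - p)"
    using assms by (subst prod.If_cases) (auto simp: Int_absorb1 Diff_eq)
  finally show ?thesis by simp
qed

text \<open>States on \<open>F\<close> are independent of states on \<open>K\<close>, and by
  \<open>restr\<close> the event \<open>C Y\<close> depends on the latter only. So the revealed open
  set can be frozen at a value \<open>Y\<close> and then averaged. This is the bridge from product
  measures to \<open>thinned_mean\<close>.\<close>

lemma prob_by_exploring:
  assumes "finite F" "F \<subseteq> I" "K \<subseteq> I" "F \<inter> K = {}" "0 \<le> p" "p \<le> 1"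
    and C: "\<And>Y. Measurable.pred (bernoulli_field K p) (C Y)"
    and restr: "\<And>Y \<omega>. C Y (restrict \<omega> K) = C Y \<omega>"
  shows "measure (bernoulli_field I p) {\<omega> \<in> space (bernoulli_field I p). C {i\<in>F. \<omega> i} \<omega>} =
    thinned_mean p F (\<lambda>Y. measure (bernoulli_field I p) {\<omega> \<in> space (bernoulli_field I p). C Y \<omega>})"
proof -
  let ?M = "bernoulli_field I p"
  interpret prob_space ?M by (rule prob_space_bernoulli_field)
  have indep: "indep_var (bernoulli_field F p) (\<lambda>\<omega>. restrict \<omega> F) (bernoulli_field K p) (\<lambda>\<omega>. restrict \<omega> K)"
    using indep_var_restrict[OF indep_coordinates assms(4,2,3)] by simp
  have rF: "(\<lambda>\<omega>. restrict \<omega> F) \<in> measurable ?M (bernoulli_field F p)"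
    and rK: "(\<lambda>\<omega>. restrict \<omega> K) \<in> measurable ?M (bernoulli_field K p)"
    using assms by (auto intro: measurable_restrict_subset)
  let ?A = "\<lambda>Y. {\<omega> \<in> space (bernoulli_field F p). {i\<in>F. \<omega> i} = Y}"
  let ?B = "\<lambda>Y. {\<omega> \<in> space (bernoulli_field K p). C Y \<omega>}"
  have A: "?A Y \<in> sets (bernoulli_field F p)" if "Y \<subseteq> F" for Y
  proof -
    have "?A Y = (\<Pi>\<^sub>E i\<in>F. {i \<in> Y})" using that by (auto simp: space_PiM PiE_iff extensional_def)
    then show ?thesis using assms by (auto intro: sets_PiM_I_finite)
  qed
  have B: "?B Y \<in> sets (bernoulli_field K p)" for Y using C by (simp add: pred_def)
  have vA: "(\<lambda>\<omega>. restrict \<omega> F) -` ?A Y \<inter> space ?M = {\<omega> \<in> space ?M. {i\<in>F. \<omega> i} = Y}" for Y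
    using assms by (auto simp: space_PiM)
  have vB: "(\<lambda>\<omega>. restrict \<omega> K) -` ?B Y \<inter> space ?M = {\<omega> \<in> space ?M. C Y \<omega>}" for Y
    using assms restr by (auto simp: space_PiM)
  have meas: "{\<omega> \<in> space ?M. {i\<in>F. \<omega> i} = Y} \<in> sets ?M" if "Y \<subseteq> F" for Y
    using measurable_sets[OF rF A[OF that]] unfolding vA .
  have measC: "{\<omega> \<in> space ?M. C Y \<omega>} \<in> sets ?M" for Y
    using measurable_sets[OF rK B] unfolding vB .
  let ?D = "\<lambda>Y. {\<omega> \<in> space ?M. {i\<in>F. \<omega> i} = Y} \<inter> {\<omega> \<in> space ?M. C Y \<omega>}"
  have D: "prob (?D Y) = p ^ card Y * (1 - p) ^ card (F - Y) * prob {\<omega> \<in> space ?M. C Y \<omega>}"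
    if "Y \<subseteq> F" for Y
  proof -
    have "(\<lambda>\<omega>. (restrict \<omega> F, restrict \<omega> K)) -` (?A Y \<times> ?B Y) \<inter> space ?M =
        ((\<lambda>\<omega>. restrict \<omega> F) -` ?A Y \<inter> space ?M) \<inter> ((\<lambda>\<omega>. restrict \<omega> K) -` ?B Y \<inter> space ?M)"
      by blast
    then show ?thesis
      using indep_varD[OF indep A[OF that] B[of Y]] prob_open_set[OF assms(1,2) that assms(5,6)]
      unfolding vA vB by simp
  qed
  have "{\<omega> \<in> space ?M. C {i\<in>F. \<omega> i} \<omega>} = (\<Union>Y\<in>Pow F. ?D Y)"
  proof (intro antisym subsetI)
    fix \<omega> assume "\<omega> \<in> {\<omega> \<in> space ?M. C {i\<in>F. \<omega> i} \<omega>}"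
    then show "\<omega> \<in> (\<Union>Y\<in>Pow F. ?D Y)" by (intro UN_I[of "{i\<in>F. \<omega> i}"]) simp_all
  qed fastforce
  also have "prob \<dots> = (\<Sum>Y\<in>Pow F. prob (?D Y))"
  proof (rule finite_measure_finite_Union)
    show "finite (Pow F)" using assms by simp
    show "?D ` Pow F \<subseteq> sets ?M" using meas measC by (intro image_subsetI sets.Int) simp_all
    show "disjoint_family_on ?D (Pow F)" unfolding disjoint_family_on_def by blast
  qed
  also have "\<dots> = thinned_mean p F (\<lambda>Y. prob {\<omega> \<in> space ?M. C Y \<omega>})"
    unfolding thinned_mean_def using D by (intro sum.cong) auto
  finally show ?thesis .
qed

section \<open>Clusters\<close>

abbreviation open_arcs :: "'v edge set \<Rightarrow> ('v edge \<Rightarrow> bool) \<Rightarrow> ('v \<times> 'v) set" where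
  "open_arcs E \<omega> \<equiv> {(u, w). \<exists>e\<in>E. \<omega> e \<and> traverses e u w}"

text \<open>The start is a set because an exploration carries along several reached vertices that
  still await inspection.\<close>

definition cluster :: "'v edge set \<Rightarrow> ('v edge \<Rightarrow> bool) \<Rightarrow> 'v set \<Rightarrow> 'v set" where
  "cluster E \<omega> A = (open_arcs E \<omega>)\<^sup>* `` A"

definition avoiding :: "'v edge set \<Rightarrow> 'v set \<Rightarrow> 'v edge set" where
  "avoiding E P = {e\<in>E. ends e \<inter> P = {}}"

text \<open>Edges oriented into \<open>v\<close> are left out: they allow no step away from
  \<open>v\<close>.\<close>

definition exits :: "'v edge set \<Rightarrow> 'v \<Rightarrow> 'v edge set" where
  "exits E v = {e\<in>E. \<exists>u. traverses e v u}"

definition targets :: "'v edge set \<Rightarrow> 'v \<Rightarrow> 'v set" where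
  "targets T v = {u. \<exists>e\<in>T. traverses e v u}"

lemma ends_traverses: "traverses e u w \<Longrightarrow> ends e = {u, w}"
  by (cases e) auto

lemma traverses_target_unique: "traverses e v u \<Longrightarrow> traverses e v w \<Longrightarrow> u = w"
  by (cases e) auto

lemma finite_ends [simp]: "finite (ends e)"
  by (cases e) auto

lemma finite_targets: "finite T \<Longrightarrow> finite (targets T v)"
proof -
  have "targets T v \<subseteq> (\<Union>e\<in>T. ends e)" by (auto simp: targets_def dest: ends_traverses)
  then show "finite T \<Longrightarrow> ?thesis" by (auto intro: finite_subset)
qed

lemma avoiding_subset: "avoiding E P \<subseteq> E"
  by (auto simp: avoiding_def)

lemma cluster_empty [simp]: "cluster E \<omega> {} = {}"
  by (simp add: cluster_def)

lemma exits_subset: "exits E v \<subseteq> {e\<in>E. v \<in> ends e}"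
  by (auto simp: exits_def dest: ends_traverses)

lemma exits_avoiding_subset: "exits (avoiding E P) v \<subseteq> exits E v"
  by (auto simp: exits_def avoiding_def)

lemma countable_avoiding: "countable E \<Longrightarrow> countable (avoiding E P)"
  using avoiding_subset by (rule countable_subset)

lemma exits_Int_avoiding: "exits E v \<inter> avoiding E' {v} = {}"
  by (auto simp: exits_def avoiding_def dest: ends_traverses)

lemma exits_edges_subset: "exits E v \<subseteq> E"
  by (auto simp: exits_def)

lemma targets_Un: "targets (S \<union> T) v = targets S v \<union> targets T v"
  by (auto simp: targets_def)

lemma countable_targets: "finite T \<Longrightarrow> countable (targets T v)"
  by (intro countable_finite finite_targets)

lemma cluster_start: "A \<subseteq> cluster E \<omega> A"
  by (auto simp: cluster_def)

lemma cluster_mono: "E \<subseteq> E' \<Longrightarrow> A \<subseteq> A' \<Longrightarrow> cluster E \<omega> A \<subseteq> cluster E' \<omega> A'"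
  unfolding cluster_def by (intro Image_mono rtrancl_mono) auto

lemma cluster_restrict: "E \<subseteq> K \<Longrightarrow> cluster E (restrict \<omega> K) A = cluster E \<omega> A"
proof -
  assume "E \<subseteq> K"
  then have "open_arcs E (restrict \<omega> K) = open_arcs E \<omega>" by auto
  then show ?thesis unfolding cluster_def by simp
qed

lemma cluster_UN: "cluster E \<omega> A = (\<Union>a\<in>A. cluster E \<omega> {a})"
  by (auto simp: cluster_def)

lemma cluster_closed:
  "u \<in> cluster E \<omega> A \<Longrightarrow> e \<in> E \<Longrightarrow> \<omega> e \<Longrightarrow> traverses e u w \<Longrightarrow> w \<in> cluster E \<omega> A"
  unfolding cluster_def by (auto intro: rtrancl_into_rtrancl)

lemma cluster_least:
  assumes "A \<subseteq> S" "\<And>u w e. u \<in> S \<Longrightarrow> e \<in> E \<Longrightarrow> \<omega> e \<Longrightarrow> traverses e u w \<Longrightarrow> w \<in> S"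
  shows "cluster E \<omega> A \<subseteq> S"
proof
  fix w assume "w \<in> cluster E \<omega> A"
  then obtain a where "a \<in> A" "(a, w) \<in> (open_arcs E \<omega>)\<^sup>*" by (auto simp: cluster_def)
  from this(2) show "w \<in> S"
    by induction (use assms \<open>a \<in> A\<close> in auto)
qed

lemma cluster_subset_ends: "cluster E \<omega> A \<subseteq> A \<union> (\<Union>e\<in>E. ends e)"
  by (rule cluster_least) (auto dest: ends_traverses)

text \<open>No remaining edge has an end in \<open>P\<close>, so a vertex of \<open>P\<close> can
  only occur as a starting point.\<close>

lemma cluster_avoiding: "cluster (avoiding E P) \<omega> A \<inter> P \<subseteq> A"
proof -
  have "cluster (avoiding E P) \<omega> A \<subseteq> A \<union> - P"
    by (rule cluster_least) (auto simp: avoiding_def dest: ends_traverses)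
  then show ?thesis by auto
qed

text \<open>An open path from \<open>A\<close> that meets \<open>v\<close> can be cut at its last
  visit there. Once the exits of \<open>v\<close> are inspected, every edge at \<open>v\<close> can
  therefore be dropped, and what remains depends on uninspected edges only.\<close>

lemma cluster_step:
  assumes "v \<in> A"
  shows "cluster E \<omega> A = insert v (cluster (avoiding E {v}) \<omega>
    (A \<union> targets {e\<in>exits E v. \<omega> e} v - {v}))" (is "_ = insert v (cluster _ _ ?A)")
proof (rule antisym)
  let ?C = "cluster (avoiding E {v}) \<omega> ?A"
  have start: "?A \<subseteq> ?C" by (rule cluster_start)
  show "cluster E \<omega> A \<subseteq> insert v ?C"
  proof (rule cluster_least)
    show "A \<subseteq> insert v ?C" using start by auto
  next
    fix u w e
    assume u: "u \<in> insert v ?C" and e: "e \<in> E" "\<omega> e" "traverses e u w"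
    consider "w = v" | "w \<noteq> v" "u = v" | "w \<noteq> v" "u \<noteq> v" by blast
    then show "w \<in> insert v ?C"
    proof cases
      case 2
      then have "w \<in> ?A" using e by (auto simp: targets_def exits_def)
      then show ?thesis using start by blast
    next
      case 3
      then have "e \<in> avoiding E {v}" using e by (auto simp: avoiding_def dest: ends_traverses)
      moreover have "u \<in> ?C" using 3 u by simp
      ultimately show ?thesis using e cluster_closed by fast
    qed simp
  qed
  have A: "A \<subseteq> cluster E \<omega> A" by (rule cluster_start)
  have "targets {e\<in>exits E v. \<omega> e} v \<subseteq> cluster E \<omega> A"
    using assms A cluster_closed by (fastforce simp: targets_def exits_def)
  then have "?A \<subseteq> cluster E \<omega> A" using A by blast
  then have "?C \<subseteq> cluster E \<omega> A"
    by (rule cluster_least) (use avoiding_subset cluster_closed in fast)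
  then show "insert v ?C \<subseteq> cluster E \<omega> A" using assms A by blast
qed

section \<open>Infinite clusters and self-avoiding paths\<close>

text \<open>Removing \<open>v\<close> leaves an infinite union of clusters, one for each of the
  finitely many vertices reached from \<open>v\<close> by an open edge; one of them must be
  infinite.\<close>

lemma infinite_cluster_step:
  assumes "finite (exits E v)" "infinite (cluster E \<omega> {v})"
  obtains e u where "e \<in> E" "\<omega> e" "traverses e v u" "u \<noteq> v"
    "infinite (cluster (avoiding E {v}) \<omega> {u})"
proof -
  let ?A = "targets {e\<in>exits E v. \<omega> e} v - {v}"
  have "infinite (cluster (avoiding E {v}) \<omega> ?A)"
    using assms(2) cluster_step[of v "{v}" E \<omega>] by (simp add: insert_Diff_if)
  moreover have "finite ?A" using assms(1) by (simp add: finite_targets)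
  ultimately obtain u where "u \<in> ?A" "infinite (cluster (avoiding E {v}) \<omega> {u})"
    by (subst (asm) cluster_UN) auto
  then show thesis using that by (auto simp: targets_def exits_def)
qed

lemma avoiding_avoiding: "avoiding (avoiding E P) Q = avoiding E (P \<union> Q)"
  by (auto simp: avoiding_def)

lemma avoiding_empty [simp]: "avoiding E {} = E"
  by (auto simp: avoiding_def)

text \<open>Koenig's lemma: keep moving to a neighbour whose cluster off the visited vertices is
  infinite. Deleting visited vertices makes the path self-avoiding.\<close>

lemma infinite_cluster_percolates:
  assumes fin: "\<And>v. finite (exits (edges G) v)" and inf: "infinite (cluster (edges G) \<omega> {x})"
  shows "percolates G x \<omega>"
proof -
  let ?E = "edges G"
  \<comment> \<open>A state \<open>(P, v)\<close> consists of the vertices \<open>P\<close> already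
    left and the current vertex \<open>v\<close>.\<close>
  let ?ok = "\<lambda>(P, v). v \<notin> P \<and> infinite (cluster (avoiding ?E P) \<omega> {v})"
  let ?step = "\<lambda>(P, v) (Q, u). Q = insert v P \<and> (\<exists>e\<in>?E. \<omega> e \<and> traverses e v u)"
  have "\<exists>g. \<forall>n. (?ok (g n) \<and> (n = 0 \<longrightarrow> g n = ({}, x))) \<and> ?step (g n) (g (Suc n))"
  proof (rule dependent_nat_choice)
    show "\<exists>y. ?ok y \<and> (0 = (0::nat) \<longrightarrow> y = ({}, x))" using inf by auto
  next
    fix y :: "'a set \<times> 'a" and n :: nat
    assume "?ok y \<and> (n = 0 \<longrightarrow> y = ({}, x))"
    then obtain P v where y: "y = (P, v)" "v \<notin> P" "infinite (cluster (avoiding ?E P) \<omega> {v})"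
      by (cases y) auto
    have "exits (avoiding ?E P) v \<subseteq> exits ?E v" by (auto simp: exits_def avoiding_def)
    then have "finite (exits (avoiding ?E P) v)" using fin finite_subset by blast
    from infinite_cluster_step[OF this y(3)] obtain e u where
      e: "e \<in> avoiding ?E P" "\<omega> e" "traverses e v u" "u \<noteq> v"
      "infinite (cluster (avoiding ?E (insert v P)) \<omega> {u})"
      by (auto simp: avoiding_avoiding)
    have "u \<notin> P" using e ends_traverses[OF e(3)] by (auto simp: avoiding_def)
    then show "\<exists>z. (?ok z \<and> (Suc n = 0 \<longrightarrow> z = ({}, x))) \<and> ?step y z"
      using e y by (intro exI[of _ "(insert v P, u)"]) (auto simp: avoiding_def)
  qed
  then obtain g where g: "\<forall>n. (?ok (g n) \<and> (n = 0 \<longrightarrow> g n = ({}, x))) \<and> ?step (g n) (g (Suc n))"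
    by (rule exE)
  have ok: "?ok (g n)" and step: "?step (g n) (g (Suc n))" for n
    using spec[OF g, of n] by (simp_all only: simp_thms)
  have g0: "g 0 = ({}, x)" using spec[OF g, of 0] by (simp only: simp_thms)
  let ?f = "\<lambda>n. snd (g n)"
  \<comment> \<open>Earlier positions stay in the visited set, which never contains the current
    vertex; injectivity follows.\<close>
  have visited: "?f m \<in> fst (g n)" if "m < n" for m n
    using that
  proof (induction n)
    case (Suc n)
    then show ?case using step[of n] by (cases "m = n") (auto split: prod.splits)
  qed simp
  have "?f m \<noteq> ?f n" if "m < n" for m n
    using visited[OF that] ok[of n] by (auto split: prod.splits)
  then have "inj ?f" by (intro injI) (metis linorder_neqE_nat)
  moreover have "\<exists>e\<in>?E. \<omega> e \<and> traverses e (?f n) (?f (Suc n))" for n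
    using step[of n] by (auto split: prod.splits)
  ultimately show ?thesis using g0 unfolding percolates_def by (intro exI[of _ ?f]) auto
qed

lemma percolates_infinite_cluster:
  assumes "percolates G x \<omega>"
  shows "infinite (cluster (edges G) \<omega> {x})"
proof -
  obtain f :: "nat \<Rightarrow> 'a" where f: "f 0 = x" "inj f"
      "\<And>n. \<exists>e\<in>edges G. \<omega> e \<and> traverses e (f n) (f (Suc n))"
    using assms by (auto simp: percolates_def)
  have "f n \<in> cluster (edges G) \<omega> {x}" for n
  proof (induction n)
    case 0
    then show ?case using f(1) cluster_start[of "{x}"] by auto
  next
    case (Suc n)
    then show ?case using f(3)[of n] by (auto intro: cluster_closed)
  qed
  then have "range f \<subseteq> cluster (edges G) \<omega> {x}" by auto
  then show ?thesis using f(2) finite_subset range_inj_infinite by blast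
qed

lemma percolates_iff_infinite_cluster:
  assumes "\<And>v. finite (exits (edges G) v)"
  shows "percolates G x \<omega> \<longleftrightarrow> infinite (cluster (edges G) \<omega> {x})"
  by (rule iffI[OF percolates_infinite_cluster infinite_cluster_percolates[OF assms]])

section \<open>Laws of cluster sizes\<close>

text \<open>Phrased through finite subsets because \<open>card\<close> is 0 on infinite sets, so
  \<open>n \<le> card X\<close> would misjudge them.\<close>

definition at_least :: "nat \<Rightarrow> 'a set \<Rightarrow> bool" where
  "at_least n X \<longleftrightarrow> (\<exists>S. S \<subseteq> X \<and> finite S \<and> card S = n)"

lemma at_least_0 [simp]: "at_least 0 X"
  by (auto simp: at_least_def)

lemma at_least_empty [simp]: "at_least n {} \<longleftrightarrow> n = 0"
  by (auto simp: at_least_def)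

lemma at_least_mono: "at_least n X \<Longrightarrow> X \<subseteq> Y \<Longrightarrow> at_least n Y"
  by (auto simp: at_least_def)

lemma at_least_SucD: "at_least (Suc n) X \<Longrightarrow> at_least n X"
  unfolding at_least_def by (metis Suc_leD obtain_subset_with_card_n order_refl subset_trans)

lemma at_least_Suc_insert: "v \<notin> X \<Longrightarrow> at_least (Suc n) (insert v X) \<longleftrightarrow> at_least n X"
proof
  assume v: "v \<notin> X" and "at_least (Suc n) (insert v X)"
  then obtain S where S: "S \<subseteq> insert v X" "finite S" "card S = Suc n" by (auto simp: at_least_def)
  then have "card (S - {v}) \<ge> n" by (auto simp: card_Diff_singleton_if)
  then obtain T where "T \<subseteq> S - {v}" "card T = n" "finite T"
    using S obtain_subset_with_card_n by (metis finite_Diff finite_subset)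
  then show "at_least n X" using S unfolding at_least_def by blast
next
  assume v: "v \<notin> X" and "at_least n X"
  then obtain S where S: "S \<subseteq> X" "finite S" "card S = n" by (auto simp: at_least_def)
  then have "card (insert v S) = Suc n" using v by (subst card_insert_disjoint) auto
  then show "at_least (Suc n) (insert v X)"
    unfolding at_least_def using S by (intro exI[of _ "insert v S"]) auto
qed

lemma at_least_SucI: "at_least n X \<Longrightarrow> v \<notin> X \<Longrightarrow> insert v X \<subseteq> Y \<Longrightarrow> at_least (Suc n) Y"
  using at_least_Suc_insert[of v X n] at_least_mono[of "Suc n" "insert v X" Y] by simp

lemma infinite_iff_at_least: "infinite X \<longleftrightarrow> (\<forall>n. at_least n X)"
proof
  show "infinite X \<Longrightarrow> \<forall>n. at_least n X"
    unfolding at_least_def by (metis infinite_arbitrarily_large)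
  assume "\<forall>n. at_least n X"
  then obtain S where "S \<subseteq> X" "card S = Suc (card X)" unfolding at_least_def by blast
  then show "infinite X" using card_mono[of X S] by auto
qed

lemma pred_Bex_countable:
  assumes "countable I" "\<And>i. i \<in> I \<Longrightarrow> Measurable.pred M (P i)"
  shows "Measurable.pred M (\<lambda>x. \<exists>i\<in>I. P i x)"
  using assms by (auto simp: pred_def intro!: sets.sets_Collect_countable_Ex')

text \<open>A countable set has countably many finite subsets, so the event is a countable union of
  finite intersections of membership events.\<close>

lemma pred_at_least:
  assumes "countable W" "\<And>x. X x \<subseteq> W" "\<And>w. Measurable.pred M (\<lambda>x. w \<in> X x)"
  shows "Measurable.pred M (\<lambda>x. at_least n (X x))"
proof -
  have "at_least n (X x) \<longleftrightarrow> (\<exists>S\<in>{S. finite S \<and> S \<subseteq> W}. card S = n \<and> (\<forall>w\<in>S. w \<in> X x))" for x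
    using assms(2)[of x] unfolding at_least_def by blast
  moreover have "Measurable.pred M
      (\<lambda>x. \<exists>S\<in>{S. finite S \<and> S \<subseteq> W}. card S = n \<and> (\<forall>w\<in>S. w \<in> X x))"
    using assms by (intro pred_Bex_countable countable_Collect_finite_subset
        pred_intros_logic pred_intros_finite) auto
  ultimately show ?thesis by simp
qed

text \<open>Reachability is a countable union over path lengths \<open>k\<close>, and each length is
  handled by induction on the last edge.\<close>

lemma pred_in_cluster:
  assumes "countable E" "\<And>e. e \<in> E \<Longrightarrow> Measurable.pred M (\<lambda>\<omega>. \<omega> e)"
  shows "Measurable.pred M (\<lambda>\<omega>. w \<in> cluster E \<omega> A)"
proof -
  let ?R = "\<lambda>k \<omega>. (open_arcs E \<omega> ^^ k) `` A"
  have R: "Measurable.pred M (\<lambda>\<omega>. w \<in> ?R k \<omega>)" for k w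
  proof (induction k arbitrary: w)
    case (Suc k)
    \<comment> \<open>The previous vertex is sought in the finite set \<open>ends e\<close>, so only
      countable quantifiers occur although the vertex type may be uncountable.\<close>
    have "w \<in> ?R (Suc k) \<omega> \<longleftrightarrow>
        (\<exists>e\<in>E. \<omega> e \<and> (\<exists>u\<in>ends e. traverses e u w \<and> u \<in> ?R k \<omega>))" for \<omega>
      by (fastforce dest: ends_traverses)
    moreover have "Measurable.pred M (\<lambda>\<omega>. \<exists>e\<in>E. \<omega> e \<and> (\<exists>u\<in>ends e. traverses e u w \<and> u \<in> ?R k \<omega>))"
      by (intro pred_Bex_countable assms pred_intros_logic Suc) (auto intro: countable_finite)
    ultimately show ?case by simp
  qed simp
  have "w \<in> cluster E \<omega> A \<longleftrightarrow> (\<exists>k\<in>(UNIV :: nat set). w \<in> ?R k \<omega>)" for \<omega>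
    by (auto simp: cluster_def rtrancl_is_UN_relpow)
  then show ?thesis using R by (simp add: pred_Bex_countable del: bex_UNIV)
qed

lemma pred_at_least_cluster:
  assumes "countable E" "countable A" "E \<subseteq> K"
  shows "Measurable.pred (bernoulli_field K p) (\<lambda>\<omega>. at_least n (\<phi> ` cluster E \<omega> A))"
proof -
  let ?W = "A \<union> (\<Union>e\<in>E. ends e)"
  have W: "countable ?W" using assms by (intro countable_Un countable_UN) (auto intro: countable_finite)
  have cl: "Measurable.pred (bernoulli_field K p) (\<lambda>\<omega>. u \<in> cluster E \<omega> A)" for u
  proof (rule pred_in_cluster[OF assms(1)])
    fix e assume "e \<in> E"
    then have "(\<lambda>\<omega>. \<omega> e) \<in> measurable (bernoulli_field K p) (measure_pmf (bernoulli_pmf p))"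
      using assms(3) by (intro measurable_component_singleton) auto
    then show "Measurable.pred (bernoulli_field K p) (\<lambda>\<omega>. \<omega> e)" by simp
  qed
  show ?thesis
  proof (rule pred_at_least)
    show "countable (\<phi> ` ?W)" using W by (rule countable_image)
    show "\<phi> ` cluster E \<omega> A \<subseteq> \<phi> ` ?W" for \<omega> using cluster_subset_ends by (rule image_mono)
  next
    fix w
    have "w \<in> \<phi> ` cluster E \<omega> A \<longleftrightarrow> (\<exists>u\<in>{u\<in>?W. \<phi> u = w}. u \<in> cluster E \<omega> A)" for \<omega>
      using cluster_subset_ends[of E \<omega> A] by blast
    moreover have "Measurable.pred (bernoulli_field K p) (\<lambda>\<omega>. \<exists>u\<in>{u\<in>?W. \<phi> u = w}. u \<in> cluster E \<omega> A)"
      by (rule pred_Bex_countable[OF countable_subset[OF _ W] cl]) auto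
    ultimately show "Measurable.pred (bernoulli_field K p) (\<lambda>\<omega>. w \<in> \<phi> ` cluster E \<omega> A)" by simp
  qed
qed

text \<open>The index set \<open>I\<close> of the measure stays fixed while the edge set
  \<open>E\<close> shrinks during exploration. The map \<open>\<phi>\<close> is \<open>id\<close> on
  \<open>G\<close> and \<open>fst\<close> on the ladder, where only distinct projections are
  counted.\<close>

definition cluster_tail :: "'v edge set \<Rightarrow> real \<Rightarrow> ('v \<Rightarrow> 'w) \<Rightarrow> 'v edge set \<Rightarrow> 'v set \<Rightarrow> nat \<Rightarrow> real" where
  "cluster_tail I p \<phi> E A n = measure (bernoulli_field I p)
     {\<omega> \<in> space (bernoulli_field I p). at_least n (\<phi> ` cluster E \<omega> A)}"

lemma cluster_tail_empty: "cluster_tail I p \<phi> E {} (Suc n) = 0"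
  by (simp add: cluster_tail_def)

lemma cluster_tail_0: "cluster_tail I p \<phi> E A 0 = 1"
proof -
  interpret prob_space "bernoulli_field I p" by (rule prob_space_bernoulli_field)
  show ?thesis using prob_space by (simp add: cluster_tail_def)
qed

lemma cluster_tail_mono:
  assumes "countable E" "countable A'" "E \<subseteq> I" "A \<subseteq> A'"
  shows "cluster_tail I p \<phi> E A n \<le> cluster_tail I p \<phi> E A' n"
proof -
  interpret prob_space "bernoulli_field I p" by (rule prob_space_bernoulli_field)
  have "{\<omega> \<in> space (bernoulli_field I p). at_least n (\<phi> ` cluster E \<omega> A')} \<in> sets (bernoulli_field I p)"
    using pred_at_least_cluster[OF assms(1-3)] by (simp add: pred_def)
  moreover have sub: "\<phi> ` cluster E \<omega> A \<subseteq> \<phi> ` cluster E \<omega> A'" for \<omega>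
    using assms(4) by (intro image_mono cluster_mono) auto
  ultimately show ?thesis
    unfolding cluster_tail_def by (intro finite_measure_mono) (auto intro: at_least_mono[OF _ sub])
qed

lemma cluster_tail_exploring:
  assumes "finite F" "F \<subseteq> I" "E \<subseteq> I" "F \<inter> E = {}" "0 \<le> p" "p \<le> 1"
    and "countable E" "\<And>Y. countable (A Y)"
  shows "measure (bernoulli_field I p) {\<omega> \<in> space (bernoulli_field I p).
      at_least n (\<phi> ` cluster E \<omega> (A {e\<in>F. \<omega> e}))} =
    thinned_mean p F (\<lambda>Y. cluster_tail I p \<phi> E (A Y) n)"
  unfolding cluster_tail_def
  by (rule prob_by_exploring[OF assms(1-6), where C = "\<lambda>Y \<omega>. at_least n (\<phi> ` cluster E \<omega> (A Y))"])
    (use assms in \<open>auto intro: pred_at_least_cluster simp: cluster_restrict\<close>)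

text \<open>The inspected vertex \<open>v\<close> contributes one point and is never met again, so
  \<open>n\<close> further points must be found through fresh edges.\<close>

lemma cluster_tail_step:
  assumes "E \<subseteq> I" "countable E" "countable A" "v \<in> A" "finite (exits E v)" "0 \<le> p" "p \<le> 1"
  shows "cluster_tail I p id E A (Suc n) = thinned_mean p (exits E v)
    (\<lambda>Y. cluster_tail I p id (avoiding E {v}) (A \<union> targets (Y \<inter> exits E v) v - {v}) n)"
proof -
  \<comment> \<open>Intersecting with \<open>exits E v\<close> makes the start set countable for
    every \<open>Y\<close>, as \<open>cluster_tail_exploring\<close> requires.\<close>
  let ?A = "\<lambda>Y. A \<union> targets (Y \<inter> exits E v) v - {v}"
  have "at_least (Suc n) (id ` cluster E \<omega> A) \<longleftrightarrow>
      at_least n (id ` cluster (avoiding E {v}) \<omega> (?A {e\<in>exits E v. \<omega> e}))" for \<omega>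
  proof -
    have eq: "{e\<in>exits E v. \<omega> e} \<inter> exits E v = {e\<in>exits E v. \<omega> e}" by auto
    have "v \<notin> cluster (avoiding E {v}) \<omega> (?A {e\<in>exits E v. \<omega> e})"
      using cluster_avoiding[of E "{v}"] by blast
    then show ?thesis
      unfolding cluster_step[OF assms(4)] eq by (simp add: at_least_Suc_insert)
  qed
  then have "cluster_tail I p id E A (Suc n) =
    measure (bernoulli_field I p) {\<omega> \<in> space (bernoulli_field I p).
      at_least n (id ` cluster (avoiding E {v}) \<omega> (?A {e\<in>exits E v. \<omega> e}))}"
    by (simp add: cluster_tail_def)
  also have "\<dots> = thinned_mean p (exits E v) (\<lambda>Y. cluster_tail I p id (avoiding E {v}) (?A Y) n)"
    using assms exits_edges_subset[of E v] avoiding_subset[of E "{v}"]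
    by (intro cluster_tail_exploring exits_Int_avoiding countable_avoiding)
      (auto intro!: countable_targets)
  finally show ?thesis .
qed

lemma pred_infinite_cluster:
  assumes "countable E" "countable A" "E \<subseteq> K"
  shows "Measurable.pred (bernoulli_field K p) (\<lambda>\<omega>. infinite (\<phi> ` cluster E \<omega> A))"
  unfolding infinite_iff_at_least using pred_at_least_cluster[OF assms] by measurable

section \<open>Path counting and positivity of the critical value\<close>

text \<open>Union bound over the first edge: one of at most \<open>D\<close> exits is open and leads
  to an infinite cluster off \<open>v\<close>. These two events are independent, so each step gains
  a factor \<open>D * p\<close>. The edge set varies in the induction because \<open>v\<close> is
  deleted.\<close>

lemma prob_infinite_cluster_le:
  assumes "E \<subseteq> I" "countable E" "0 \<le> p" "p \<le> 1"
    and "\<And>v. finite (exits E v) \<and> card (exits E v) \<le> D"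
  shows "measure (bernoulli_field I p)
    {\<omega> \<in> space (bernoulli_field I p). infinite (cluster E \<omega> {v})} \<le> (D * p) ^ k"
  using assms(1,2,5)
proof (induction k arbitrary: E v)
  case 0
  interpret prob_space "bernoulli_field I p" by (rule prob_space_bernoulli_field)
  show ?case by simp
next
  case (Suc k)
  let ?M = "bernoulli_field I p"
  let ?E = "avoiding E {v}"
  interpret prob_space ?M by (rule prob_space_bernoulli_field)
  \<comment> \<open>The far end of \<open>e\<close> as seen from \<open>v\<close>; it is unique for
    every edge that can be crossed from \<open>v\<close>.\<close>
  define t where "t e = (SOME u. traverses e v u)" for e
  have t: "traverses e v u \<Longrightarrow> t e = u" for e u
    unfolding t_def by (rule some_equality) (auto intro: traverses_target_unique)
  let ?B = "\<lambda>e. {\<omega> \<in> space ?M. \<omega> e \<and> infinite (cluster ?E \<omega> {t e})}"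
  have E: "?E \<subseteq> I" "countable ?E" "?E \<subseteq> E"
    using avoiding_subset Suc.prems countable_avoiding by blast+
  have fin: "finite (exits E v)" and card: "card (exits E v) \<le> D" using Suc.prems(3) by auto
  have pred: "Measurable.pred (bernoulli_field K p) (\<lambda>\<omega>. infinite (cluster ?E \<omega> {u}))"
    if "?E \<subseteq> K" for u K
    using pred_infinite_cluster[OF E(2) _ that, of "{u}" id p] by simp
  have open_e: "Measurable.pred ?M (\<lambda>\<omega>. \<omega> e)" if "e \<in> I" for e
  proof -
    have "(\<lambda>\<omega>. \<omega> e) \<in> measurable ?M (measure_pmf (bernoulli_pmf p))"
      using that by (intro measurable_component_singleton)
    then show ?thesis by simp
  qed
  have exI: "exits E v \<subseteq> I" using exits_edges_subset Suc.prems(1) by (rule order_trans)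
  have B: "?B e \<in> events" if "e \<in> exits E v" for e
    using pred[OF E(1), of "t e"] open_e[of e] that exI
    by (auto simp: pred_def intro!: sets.sets_Collect_conj)
  have IH: "prob {\<omega> \<in> space ?M. infinite (cluster ?E \<omega> {u})} \<le> (D * p) ^ k" for u
  proof (rule Suc.IH[OF E(1,2)])
    fix w
    show "finite (exits ?E w) \<and> card (exits ?E w) \<le> D"
      using Suc.prems(3)[of w] exits_avoiding_subset[of E "{v}" w]
      by (meson card_mono finite_subset order_trans)
  qed
  have B_le: "prob (?B e) \<le> p * (D * p) ^ k" if e: "e \<in> exits E v" for e
  proof -
    \<comment> \<open>Revealing the single edge \<open>e\<close>, which is not among the edges
      avoiding \<open>v\<close>, splits off the factor \<open>p\<close>.\<close>
    let ?C = "\<lambda>Y \<omega>. e \<in> Y \<and> infinite (cluster ?E \<omega> {t e})"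
    have "{e} \<inter> ?E = {}" using exits_Int_avoiding[of E v E] e by blast
    then have "prob {\<omega> \<in> space ?M. ?C {i\<in>{e}. \<omega> i} \<omega>} =
        thinned_mean p {e} (\<lambda>Y. prob {\<omega> \<in> space ?M. ?C Y \<omega>})"
      using e exI E assms(3,4) pred
      by (intro prob_by_exploring[where K = ?E]) (auto simp: cluster_restrict)
    also have "\<dots> = p * prob {\<omega> \<in> space ?M. infinite (cluster ?E \<omega> {t e})}"
      by (simp add: thinned_mean_insert)
    also have "\<dots> \<le> p * (D * p) ^ k" using IH assms(3) by (intro mult_left_mono)
    finally show ?thesis by simp
  qed
  have "{\<omega> \<in> space ?M. infinite (cluster E \<omega> {v})} \<subseteq> (\<Union>e\<in>exits E v. ?B e)"
  proof
    fix \<omega> assume \<omega>: "\<omega> \<in> {\<omega> \<in> space ?M. infinite (cluster E \<omega> {v})}"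
    then have "infinite (cluster E \<omega> {v})" by simp
    then obtain e u where e: "e \<in> E" "\<omega> e" "traverses e v u" "infinite (cluster ?E \<omega> {u})"
      by (rule infinite_cluster_step[OF fin])
    then have "e \<in> exits E v" by (auto simp: exits_def)
    moreover have "\<omega> \<in> ?B e" using e \<omega> t[OF e(3)] by simp
    ultimately show "\<omega> \<in> (\<Union>e\<in>exits E v. ?B e)" by (rule UN_I)
  qed
  then have "prob {\<omega> \<in> space ?M. infinite (cluster E \<omega> {v})} \<le> prob (\<Union>e\<in>exits E v. ?B e)"
    using B fin by (intro finite_measure_mono) auto
  also have "\<dots> \<le> (\<Sum>e\<in>exits E v. prob (?B e))"
    using B fin by (intro finite_measure_subadditive_finite) auto
  also have "\<dots> \<le> (\<Sum>e\<in>exits E v. p * (D * p) ^ k)" using B_le by (rule sum_mono)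
  also have "\<dots> = card (exits E v) * (p * (D * p) ^ k)" by simp
  also have "\<dots> \<le> D * (p * (D * p) ^ k)"
    using card assms(3) by (intro mult_right_mono) auto
  finally show ?case by (simp add: mult_ac)
qed

text \<open>If \<open>D * p < 1\<close>, the bounds \<open>(D * p) ^ k\<close> tend to 0. This keeps
  the critical value away from 0.\<close>

lemma percolation_prob_pos_imp:
  assumes "countable (edges G)" "0 \<le> p" "p \<le> 1"
    and "\<And>v. finite (exits (edges G) v) \<and> card (exits (edges G) v) \<le> D"
    and "0 < percolation_prob G x p"
  shows "1 \<le> D * p"
proof (rule ccontr)
  assume "\<not> 1 \<le> D * p"
  then have lim: "(\<lambda>k. (D * p) ^ k) \<longlonglongrightarrow> 0" using assms(2) by (intro LIMSEQ_realpow_zero) auto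
  have "percolation_prob G x p \<le> (D * p) ^ k" for k
    using prob_infinite_cluster_le[OF order_refl assms(1-4), of x k] assms(4)
    by (simp add: percolation_prob_def bond_percolation_def percolates_iff_infinite_cluster)
  then have "percolation_prob G x p \<le> 0" by (intro LIMSEQ_le_const[OF lim]) auto
  then show False using assms(5) by simp
qed

section \<open>Ladders\<close>

abbreviation lift :: "nat \<Rightarrow> 'v edge \<Rightarrow> ('v \<times> nat) edge" where
  "lift n \<equiv> map_edge (\<lambda>v. (v, n))"

abbreviation rung :: "'v \<times> nat \<Rightarrow> ('v \<times> nat) edge" where
  "rung x \<equiv> Oriented x (fst x, Suc (snd x))"

lemma traverses_lift: "traverses e v u \<Longrightarrow> traverses (lift n e) (v, n) (u, n)"
  by (cases e) auto

lemma ends_lift [simp]: "ends (lift n e) = (\<lambda>v. (v, n)) ` ends e"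
  by (simp add: edge.set_map)

lemma ends_nonempty [simp]: "ends e \<noteq> {}"
proof (cases e)
  case (Unoriented s)
  then show ?thesis by (cases s) auto
qed auto

lemma inj_lift: "inj (lift n)"
  by (intro edge.inj_map injI) auto

text \<open>The height can be read off any end of a lifted edge. Copies at different heights are
  thus different edges, with independent states.\<close>

lemma lift_eq_iff: "lift m e = lift n e' \<longleftrightarrow> m = n \<and> e = e'"
proof
  assume eq: "lift m e = lift n e'"
  then have "(\<lambda>v. (v, m)) ` ends e = (\<lambda>v. (v, n)) ` ends e'" using ends_lift by metis
  then have "m = n" using ends_nonempty[of e] by blast
  then show "m = n \<and> e = e'" using eq inj_lift by (auto dest: injD)
qed auto

lemma lift_neq_rung: "lift n e \<noteq> rung x"
proof
  assume "lift n e = rung x"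
  then have "(\<lambda>v. (v, n)) ` ends e = ends (rung x)" using ends_lift by metis
  then have "x \<in> (\<lambda>v. (v, n)) ` ends e" "(fst x, Suc (snd x)) \<in> (\<lambda>v. (v, n)) ` ends e" by auto
  then show False by (metis imageE n_not_Suc_n snd_conv)
qed

lemma edges_ladder: "edges (ladder G) = (\<Union>n. lift n ` edges G) \<union> rung ` (verts G \<times> UNIV)"
  by (auto simp: ladder_def image_iff)

lemma traverses_liftD: "traverses (lift n e) x y \<Longrightarrow> snd x = n \<and> traverses e (fst x) (fst y)"
proof (cases e)
  case (Unoriented s)
  assume "traverses (lift n e) x y"
  then show ?thesis using Unoriented by (cases s) auto
qed auto

text \<open>Gives local finiteness of the ladder, which is needed to turn infinite clusters into
  infinite paths.\<close>

lemma exits_ladder_subset: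
  "exits (edges (ladder G)) x \<subseteq> insert (rung x) (lift (snd x) ` exits (edges G) (fst x))"
proof
  fix e assume e: "e \<in> exits (edges (ladder G)) x"
  then obtain y where y: "e \<in> edges (ladder G)" "traverses e x y" by (auto simp: exits_def)
  from y(1) consider n e' where "e' \<in> edges G" "e = lift n e'" | z where "e = rung z"
    unfolding edges_ladder by blast
  then show "e \<in> insert (rung x) (lift (snd x) ` exits (edges G) (fst x))"
  proof cases
    case 1
    then show ?thesis using y(2) by (auto simp: exits_def dest: traverses_liftD)
  qed (use y(2) in auto)
qed

section \<open>Vertex-by-vertex comparison of a graph with its ladder\<close>

text \<open>The vertex set shrinks along with the edges because the rungs of the ladder are built
  from it.\<close>

definition delete_vertex :: "'v graph \<Rightarrow> 'v \<Rightarrow> 'v graph" where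
  "delete_vertex G v = \<lparr>verts = verts G - {v}, edges = avoiding (edges G) {v}\<rparr>"

text \<open>Discarding the whole fibre over \<open>v\<close> leaves a ladder again, so an induction
  over explored vertices stays within ladders.\<close>

lemma edges_ladder_delete:
  "edges (ladder (delete_vertex G v)) = avoiding (edges (ladder G)) ({v} \<times> UNIV)"
proof -
  have "avoiding (\<Union>n. lift n ` edges G) ({v} \<times> UNIV) = (\<Union>n. lift n ` avoiding (edges G) {v})"
  proof -
    have "ends (lift n e) \<inter> {v} \<times> UNIV = {} \<longleftrightarrow> ends e \<inter> {v} = {}" for n :: nat and e
      by auto
    then show ?thesis unfolding avoiding_def by blast
  qed
  moreover have "avoiding (rung ` (verts G \<times> UNIV)) ({v} \<times> UNIV) = rung ` ((verts G - {v}) \<times> UNIV)"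
    by (auto simp: avoiding_def)
  moreover have "avoiding (X \<union> Y) P = avoiding X P \<union> avoiding Y P" for X Y :: "('a \<times> nat) edge set" and P
    by (auto simp: avoiding_def)
  ultimately show ?thesis by (simp add: edges_ladder delete_vertex_def)
qed

lemma countable_edges_ladder:
  "countable (verts G) \<Longrightarrow> countable (edges G) \<Longrightarrow> countable (edges (ladder G))"
  unfolding edges_ladder by auto

text \<open>Inspect the rung at \<open>(v, m)\<close> and the copies of the exits of
  \<open>v\<close> at heights \<open>m\<close> and \<open>Suc m\<close>. An open rung makes both
  copies usable, which gives the dense component; a closed one leaves the lower copy. Discarding the
  rest of the fibre only loses points, hence an inequality. The function \<open>h\<close> stands for
  the lower bound available after \<open>v\<close> is removed.\<close>

lemma cluster_tail_ladder_step:
  assumes "edges (ladder G) \<subseteq> J" "countable (verts G)" "countable (edges G)" "B \<subseteq> verts G \<times> UNIV"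
    and "(v, m) \<in> B" "v \<in> verts G" "finite (exits (edges G) v)" "0 \<le> p" "p \<le> 1"
    and le: "\<And>B'. B' \<subseteq> (verts G - {v}) \<times> UNIV \<Longrightarrow>
      h (fst ` B') \<le> cluster_tail J p fst (edges (ladder (delete_vertex G v))) B' n"
    and sub: "\<And>e. e \<in> edges G \<Longrightarrow> ends e \<subseteq> verts G"
  defines "F \<equiv> exits (edges G) v"
    and "g \<equiv> \<lambda>Y. h (fst ` B \<union> targets (Y \<inter> exits (edges G) v) v - {v})"
  shows "p * thinned_mean (1 - (1 - p)\<^sup>2) F g + (1 - p) * thinned_mean p F g
    \<le> cluster_tail J p fst (edges (ladder G)) B (Suc n)"
proof -
  let ?M = "bernoulli_field J p"
  interpret prob_space ?M by (rule prob_space_bernoulli_field)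
  let ?L = "edges (ladder G)"
  let ?L' = "avoiding ?L ({v} \<times> UNIV)"
  let ?r = "rung (v, m)"
  let ?H = "lift m ` F" and ?H' = "lift (Suc m) ` F"
  let ?F = "insert ?r (?H \<union> ?H')"
  \<comment> \<open>Edges crossable at the upper height; there are none unless the rung is
    open.\<close>
  define up where "up Y = (if ?r \<in> Y then {e\<in>F. lift (Suc m) e \<in> Y} else {})" for Y
  define B' where "B' Y = (B \<union> (\<lambda>u. (u, m)) ` targets {e\<in>F. lift m e \<in> Y} v
    \<union> (\<lambda>u. (u, Suc m)) ` targets (up Y) v) - {v} \<times> UNIV" for Y
  have finF: "finite F" and FE: "F \<subseteq> edges G" using assms by (auto simp: exits_def)
  have FL: "?F \<subseteq> ?L" using FE \<open>v \<in> verts G\<close> unfolding edges_ladder by auto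
  have F_v: "v \<in> ends e" if "e \<in> F" for e
    using that exits_subset unfolding F_def by fast
  \<comment> \<open>Every inspected edge touches the fibre over \<open>v\<close>, so the edges kept
    for later are all fresh.\<close>
  have "\<exists>k. (v, k) \<in> ends e" if "e \<in> ?F" for e
    using that F_v by (auto simp: image_iff)
  then have disj: "?F \<inter> ?L' = {}" unfolding avoiding_def by blast
  have countL: "countable ?L" using assms by (intro countable_edges_ladder)
  have countB: "countable B" using assms(2,4) by (rule_tac countable_subset) auto
  have countB': "countable (B' Y)" for Y
    using countB finF unfolding B'_def up_def
    by (intro countable_Diff countable_Un countable_image countable_targets) auto
  have verts_targets: "targets T v \<subseteq> verts G" if "T \<subseteq> F" for T
    using that sub FE by (fastforce simp: targets_def dest: ends_traverses)
  have B'_verts: "B' Y \<subseteq> (verts G - {v}) \<times> UNIV" for Y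
  proof -
    have "up Y \<subseteq> F" by (auto simp: up_def)
    then show ?thesis
      using verts_targets[of "{e\<in>F. lift m e \<in> Y}"] verts_targets[of "up Y"] assms(4)
      unfolding B'_def by auto
  qed
  have fst_B': "fst ` B' Y = fst ` B \<union> targets (({e\<in>F. lift m e \<in> Y} \<union> up Y) \<inter> F) v - {v}" for Y
  proof -
    have "fst ` (X - {v} \<times> UNIV) = fst ` X - {v}" for X :: "('a \<times> nat) set" by force
    moreover have "({e\<in>F. lift m e \<in> Y} \<union> up Y) \<inter> F = {e\<in>F. lift m e \<in> Y} \<union> up Y"
      by (auto simp: up_def)
    ultimately show ?thesis by (simp add: B'_def image_Un image_image targets_Un Un_assoc)
  qed
  have step: "at_least (Suc n) (fst ` cluster ?L \<omega> B)"
    if n: "at_least n (fst ` cluster ?L' \<omega> (B' {e\<in>?F. \<omega> e}))" for \<omega>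
  proof -
    let ?Y = "{e\<in>?F. \<omega> e}"
    let ?C = "cluster ?L \<omega> B"
    have B: "B \<subseteq> ?C" by (rule cluster_start)
    have low: "(u, m) \<in> ?C" if u: "u \<in> targets {e\<in>F. lift m e \<in> ?Y} v" for u
    proof -
      obtain e where e: "e \<in> F" "\<omega> (lift m e)" "traverses e v u"
        using u by (auto simp: targets_def)
      then have "lift m e \<in> ?L" using FL by auto
      moreover have "(v, m) \<in> ?C" using B assms(5) by blast
      ultimately show ?thesis using e(2) traverses_lift[OF e(3)] by (auto intro: cluster_closed)
    qed
    have high: "(u, Suc m) \<in> ?C" if u: "u \<in> targets (up ?Y) v" for u
    proof -
      obtain e where e: "e \<in> F" "\<omega> (lift (Suc m) e)" "traverses e v u" and r: "\<omega> ?r"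
        using u by (auto simp: targets_def up_def split: if_splits)
      have "(v, Suc m) \<in> ?C"
        by (rule cluster_closed[where e = ?r and u = "(v, m)"]) (use FL B assms(5) r in auto)
      moreover have "lift (Suc m) e \<in> ?L" using FL e by auto
      ultimately show ?thesis using e(2) traverses_lift[OF e(3)] by (auto intro: cluster_closed)
    qed
    have "B' ?Y \<subseteq> ?C" using B low high unfolding B'_def by blast
    then have "cluster ?L' \<omega> (B' ?Y) \<subseteq> ?C"
      by (rule cluster_least) (use avoiding_subset cluster_closed in fast)
    moreover have "v \<in> fst ` ?C" using imageI[OF subsetD[OF B assms(5)], of fst] by simp
    \<comment> \<open>The projection of the remaining cluster misses \<open>v\<close>, so
      \<open>v\<close> supplies the additional point.\<close>
    ultimately have ins: "insert v (fst ` cluster ?L' \<omega> (B' ?Y)) \<subseteq> fst ` ?C" by blast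
    have "v \<notin> fst ` cluster ?L' \<omega> (B' ?Y)"
    proof
      assume "v \<in> fst ` cluster ?L' \<omega> (B' ?Y)"
      then obtain k where "(v, k) \<in> cluster ?L' \<omega> (B' ?Y)" by auto
      then have "(v, k) \<in> B' ?Y"
        using cluster_avoiding[of ?L "{v} \<times> UNIV" \<omega> "B' ?Y"] by blast
      then show False by (simp add: B'_def)
    qed
    then show ?thesis using at_least_SucI[OF n] ins by blast
  qed
  have g_eq: "h (fst ` B' Y) = g ({e\<in>F. lift m e \<in> Y} \<union> up Y)" for Y
    unfolding fst_B' g_def F_def ..
  have rung: "?r \<notin> ?H \<union> ?H'" using lift_neq_rung by (metis UnE imageE)
  have HH: "?H \<inter> ?H' = {}" by (auto simp: lift_eq_iff)
  have lower: "{e\<in>F. lift m e \<in> lift m ` Y \<union> lift (Suc m) ` Z} = Y"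
    "{e\<in>F. lift (Suc m) e \<in> lift m ` Y \<union> lift (Suc m) ` Z} = Z"
    if "Y \<subseteq> F" "Z \<subseteq> F" for Y Z using that by (auto simp: lift_eq_iff image_iff)
  have r_notin: "?r \<notin> lift m ` Y \<union> lift (Suc m) ` Z" for Y Z
    using lift_neq_rung by (metis UnE imageE)
  have up1: "up (insert ?r (lift m ` Y \<union> lift (Suc m) ` Z)) = Z"
    and up0: "up (lift m ` Y \<union> lift (Suc m) ` Z) = {}"
    and lo1: "{e\<in>F. lift m e \<in> insert ?r (lift m ` Y \<union> lift (Suc m) ` Z)} = Y"
    if "Y \<subseteq> F" "Z \<subseteq> F" for Y Z
    using lower[OF that] r_notin lift_neq_rung[of _ _ "(v, m)"] unfolding up_def by auto
  have split: "thinned_mean p (?H \<union> ?H') k =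
      thinned_mean p F (\<lambda>Y. thinned_mean p F (\<lambda>Z. k (lift m ` Y \<union> lift (Suc m) ` Z)))" for k
    using finF HH
    by (subst thinned_mean_union) (simp_all add: thinned_mean_image inj_on_subset[OF inj_lift subset_UNIV])
  \<comment> \<open>Both terms become averages over pairs \<open>(Y, Z)\<close> of open edges at the
    lower and upper heights; with a closed rung the integrand is constant in
    \<open>Z\<close>.\<close>
  have "p * thinned_mean (1 - (1 - p)\<^sup>2) F g + (1 - p) * thinned_mean p F g =
    p * thinned_mean p F (\<lambda>Y. thinned_mean p F (\<lambda>Z. g (Y \<union> Z))) +
    (1 - p) * thinned_mean p F (\<lambda>Y. thinned_mean p F (\<lambda>Z. g Y))"
    using finF by (simp add: thinned_mean_superpose thinned_mean_const)
  also have "\<dots> = thinned_mean p ?F (\<lambda>Y. h (fst ` B' Y))"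
  proof -
    have "thinned_mean p (?H \<union> ?H') (\<lambda>Y. h (fst ` B' (insert ?r Y))) =
        thinned_mean p F (\<lambda>Y. thinned_mean p F (\<lambda>Z. g (Y \<union> Z)))"
      unfolding split g_eq by (intro thinned_mean_cong) (simp only: up1 lo1)
    moreover have "thinned_mean p (?H \<union> ?H') (\<lambda>Y. h (fst ` B' Y)) =
        thinned_mean p F (\<lambda>Y. thinned_mean p F (\<lambda>Z. g Y))"
      unfolding split g_eq by (intro thinned_mean_cong) (simp only: up0 lower Un_empty_right)
    moreover have "finite (?H \<union> ?H')" using finF by simp
    ultimately show ?thesis using thinned_mean_insert[OF _ rung] by simp
  qed
  also have "\<dots> \<le> thinned_mean p ?F (\<lambda>Y. cluster_tail J p fst ?L' (B' Y) n)"
    using assms(8,9) le[OF B'_verts] by (intro thinned_mean_mono) (simp_all add: edges_ladder_delete)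
  also have "\<dots> = prob {\<omega> \<in> space ?M. at_least n (fst ` cluster ?L' \<omega> (B' {e\<in>?F. \<omega> e}))}"
    using finF FL disj countL countB' assms(1,8,9) avoiding_subset[of ?L "{v} \<times> UNIV"]
    by (intro cluster_tail_exploring[symmetric] countable_avoiding) auto
  also have "\<dots> \<le> cluster_tail J p fst ?L B (Suc n)"
  proof -
    have "{\<omega> \<in> space ?M. at_least (Suc n) (fst ` cluster ?L \<omega> B)} \<in> events"
      using pred_at_least_cluster[OF countL countB assms(1)] by (simp add: pred_def)
    then show ?thesis
      unfolding cluster_tail_def using step by (intro finite_measure_mono) auto
  qed
  finally show ?thesis .
qed

text \<open>Induction on the number of points still to be found, for all graphs and start sets at
  once. The exact recursion in \<open>G\<close> is bounded by the mixture, and the mixture by the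
  exploration step in the ladder.\<close>

lemma cluster_tail_le_ladder:
  assumes p: "0 < p" "p < 1" and q: "0 \<le> q" "q \<le> 1" "q \<le> p + p\<^sup>2 * (1 - p) ^ Suc D"
    and "edges G \<subseteq> I" "edges (ladder G) \<subseteq> J" "countable (verts G)" "countable (edges G)"
    and "B \<subseteq> verts G \<times> UNIV" "\<And>e. e \<in> edges G \<Longrightarrow> ends e \<subseteq> verts G"
    and "\<And>v. finite (exits (edges G) v) \<and> card (exits (edges G) v) \<le> D"
  shows "cluster_tail I q id (edges G) (fst ` B) n \<le> cluster_tail J p fst (edges (ladder G)) B n"
  using assms(6-)
proof (induction n arbitrary: G B)
  case 0
  then show ?case by (simp add: cluster_tail_0)
next
  case (Suc n)
  show ?case
  proof (cases "B = {}")
    case True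
    then show ?thesis by (simp add: cluster_tail_empty)
  next
    case False
    \<comment> \<open>Both explorations inspect the same \<open>v\<close>; if \<open>B\<close> meets
      its fibre at several heights, any one of them serves.\<close>
    then obtain v m where vm: "(v, m) \<in> B" by auto
    then have v: "v \<in> verts G" "v \<in> fst ` B" using Suc.prems(5) by force+
    let ?G' = "delete_vertex G v"
    let ?F = "exits (edges G) v"
    let ?h = "\<lambda>A. cluster_tail I q id (edges ?G') A n"
    let ?g = "\<lambda>Y. ?h (fst ` B \<union> targets (Y \<inter> ?F) v - {v})"
    have finF: "finite ?F" and cardF: "card ?F \<le> D" using Suc.prems(7) by auto
    have sub: "edges ?G' \<subseteq> edges G" using avoiding_subset by (auto simp: delete_vertex_def)
    have countB: "countable (fst ` B)" using Suc.prems(3,5) by (rule_tac countable_subset) auto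
    have IH: "?h (fst ` B') \<le> cluster_tail J p fst (edges (ladder ?G')) B' n"
      if "B' \<subseteq> (verts G - {v}) \<times> UNIV" for B'
    proof (rule Suc.IH)
      show "edges ?G' \<subseteq> I" using sub Suc.prems(1) by blast
      show "edges (ladder ?G') \<subseteq> J"
        using avoiding_subset Suc.prems(2) unfolding edges_ladder_delete by blast
      show "countable (edges ?G')" using sub Suc.prems(4) by (rule countable_subset)
      show "finite (exits (edges ?G') w) \<and> card (exits (edges ?G') w) \<le> D" for w
      proof -
        have "exits (edges ?G') w \<subseteq> exits (edges G) w" using sub by (auto simp: exits_def)
        then show ?thesis
          using Suc.prems(7)[of w] by (meson card_mono finite_subset order_trans)
      qed
      show "ends e \<subseteq> verts ?G'" if "e \<in> edges ?G'" for e
        using that Suc.prems(6)[of e] by (auto simp: delete_vertex_def avoiding_def)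
    qed (use that Suc.prems(3) in \<open>auto simp: delete_vertex_def\<close>)
    have "cluster_tail I q id (edges G) (fst ` B) (Suc n) = thinned_mean q ?F ?g"
      using cluster_tail_step[OF Suc.prems(1,4) countB v(2) finF q(1,2)] by (simp add: delete_vertex_def)
    \<comment> \<open>The dense component has weight \<open>a = p\<close>, the probability of an
      open rung.\<close>
    also have "\<dots> \<le> p * thinned_mean (1 - (1 - p)\<^sup>2) ?F ?g + (1 - p) * thinned_mean p ?F ?g"
    proof (rule thinned_mean_le_mixture[OF finF p q(1,2)])
      have "(1 - p) ^ Suc D \<le> (1 - p) ^ Suc (card ?F)" using p cardF by (intro power_decreasing) auto
      then have "p\<^sup>2 * (1 - p) ^ Suc D \<le> p\<^sup>2 * (1 - p) ^ Suc (card ?F)" by (intro mult_left_mono) auto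
      then show "q \<le> p + p * (1 - p) ^ Suc (card ?F) * p"
        using q(3) by (simp add: power2_eq_square ac_simps)
    next
      fix Y Z assume YZ: "Y \<subseteq> Z" "Z \<subseteq> ?F"
      have "targets (Y \<inter> ?F) v \<subseteq> targets (Z \<inter> ?F) v" using YZ by (auto simp: targets_def)
      then show "?g Y \<le> ?g Z"
        using sub Suc.prems(1,4) countB finF countable_targets[of "Z \<inter> ?F" v]
        by (intro cluster_tail_mono) (auto intro: countable_subset)
    qed (use p in auto)
    also have "\<dots> \<le> cluster_tail J p fst (edges (ladder G)) B (Suc n)"
      by (rule cluster_tail_ladder_step[OF Suc.prems(2,3,4,5) vm v(1) finF _ _ IH Suc.prems(6)])
        (use p in auto)
    finally show ?thesis .
  qed
qed

text \<open>Let \<open>n\<close> tend to infinity in the comparison of tails, using continuity from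
  above. A ladder cluster with infinite projection is itself infinite.\<close>

lemma percolation_prob_le_ladder:
  assumes p: "0 < p" "p < 1" and q: "0 \<le> q" "q \<le> 1" "q \<le> p + p\<^sup>2 * (1 - p) ^ Suc D"
    and count: "countable (verts G)" "countable (edges G)" and x: "x \<in> verts G"
    and ends: "\<And>e. e \<in> edges G \<Longrightarrow> ends e \<subseteq> verts G"
    and deg: "\<And>v. finite (exits (edges G) v) \<and> card (exits (edges G) v) \<le> D"
  shows "percolation_prob G x q \<le> percolation_prob (ladder G) (x, 0) p"
proof -
  let ?L = "edges (ladder G)"
  let ?M = "bernoulli_field ?L p"
  let ?S = "\<lambda>n. {\<omega> \<in> space ?M. at_least n (fst ` cluster ?L \<omega> {(x, 0)})}"
  interpret M: prob_space ?M by (rule prob_space_bernoulli_field)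
  interpret N: prob_space "bernoulli_field (edges G) q" by (rule prob_space_bernoulli_field)
  have countL: "countable ?L" using count by (rule countable_edges_ladder)
  have "percolation_prob G x q \<le> M.prob (?S n)" for n
  proof -
    have "percolation_prob G x q \<le> cluster_tail (edges G) q id (edges G) {x} n"
      unfolding percolation_prob_def bond_percolation_def cluster_tail_def
    proof (rule N.finite_measure_mono)
      show "{\<omega> \<in> space (bernoulli_field (edges G) q). at_least n (id ` cluster (edges G) \<omega> {x})} \<in> N.events"
        using pred_at_least_cluster[OF count(2) _ order_refl, of "{x}" n id q] by (simp add: pred_def)
      show "{\<omega> \<in> space (bernoulli_field (edges G) q). percolates G x \<omega>} \<subseteq>
          {\<omega> \<in> space (bernoulli_field (edges G) q). at_least n (id ` cluster (edges G) \<omega> {x})}"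
        by (auto dest!: percolates_infinite_cluster[unfolded infinite_iff_at_least])
    qed
    also have "\<dots> \<le> cluster_tail ?L p fst ?L {(x, 0)} n"
      using cluster_tail_le_ladder[OF p q order_refl order_refl count _ ends deg, of "{(x, 0)}" n] x
      by simp
    finally show ?thesis by (simp add: cluster_tail_def)
  qed
  moreover have "(\<lambda>n. M.prob (?S n)) \<longlonglongrightarrow> M.prob (\<Inter>n. ?S n)"
  proof (rule M.finite_Lim_measure_decseq)
    show "range ?S \<subseteq> M.events"
      using pred_at_least_cluster[OF countL _ order_refl, of "{(x, 0)}"] by (auto simp: pred_def)
    show "decseq ?S" by (rule decseq_SucI) (auto dest: at_least_SucD)
  qed
  ultimately have "percolation_prob G x q \<le> M.prob (\<Inter>n. ?S n)"
    by (intro LIMSEQ_le_const) auto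
  also have "\<dots> \<le> percolation_prob (ladder G) (x, 0) p"
  proof -
    have fin: "finite (exits ?L y)" for y
      using deg by (intro finite_subset[OF exits_ladder_subset]) auto
    have "{\<omega> \<in> space ?M. infinite (cluster ?L \<omega> {(x, 0)})} \<in> M.events"
      using pred_infinite_cluster[OF countL _ order_refl, of "{(x, 0)}" id p] by (simp add: pred_def)
    moreover have "(\<Inter>n. ?S n) \<subseteq> {\<omega> \<in> space ?M. infinite (cluster ?L \<omega> {(x, 0)})}"
    proof
      fix \<omega> assume "\<omega> \<in> (\<Inter>n. ?S n)"
      then have "\<omega> \<in> space ?M" "infinite (fst ` cluster ?L \<omega> {(x, 0)})"
        by (simp_all add: infinite_iff_at_least)
      then show "\<omega> \<in> {\<omega> \<in> space ?M. infinite (cluster ?L \<omega> {(x, 0)})}"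
        by (auto dest: finite_imageI[where h = fst])
    qed
    ultimately show ?thesis
      unfolding percolation_prob_def bond_percolation_def percolates_iff_infinite_cluster[OF fin]
      by (intro M.finite_measure_mono)
  qed
  finally show ?thesis .
qed

section \<open>Countability of the graph and the strict inequality\<close>

text \<open>By local finiteness, finitely many vertices are reached in \<open>k\<close> steps from
  \<open>x\<close>; by connectedness these sets cover the graph.\<close>

lemma countable_connected_graph:
  assumes "connected_graph G" "x \<in> verts G" "\<And>v. finite {e\<in>edges G. v \<in> ends e}"
  shows "countable (verts G)"
proof -
  have nbrs: "finite (adjacency G `` {v})" for v
  proof (rule finite_subset)
    show "adjacency G `` {v} \<subseteq> (\<Union>e\<in>{e\<in>edges G. v \<in> ends e}. ends e)"
      by (auto simp: adjacency_def)
    show "finite (\<Union>e\<in>{e\<in>edges G. v \<in> ends e}. ends e)" using assms(3) by auto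
  qed
  have "finite ((adjacency G ^^ k) `` {x})" for k
  proof (induction k)
    case (Suc k)
    have "(adjacency G ^^ Suc k) `` {x} = (\<Union>v\<in>(adjacency G ^^ k) `` {x}. adjacency G `` {v})"
      by auto
    then show ?case using Suc nbrs by simp
  qed simp
  then have "countable (\<Union>k. (adjacency G ^^ k) `` {x})" by (auto intro: countable_finite)
  moreover have "verts G \<subseteq> (\<Union>k. (adjacency G ^^ k) `` {x})"
    using assms(1,2) by (auto simp: connected_graph_def rtrancl_is_UN_relpow)
  ultimately show ?thesis by (rule countable_subset[rotated])
qed

lemma countable_edges_simple_graph:
  assumes "simple_graph G" "countable (verts G)"
  shows "countable (edges G)"
proof -
  have "ends ` edges G \<subseteq> {A. finite A \<and> A \<subseteq> verts G}" using assms(1) by (auto simp: simple_graph_def)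
  then have "countable (ends ` edges G)"
    using countable_Collect_finite_subset[OF assms(2)] by (rule countable_subset)
  then show ?thesis using assms(1) countable_image_inj_on by (auto simp: simple_graph_def)
qed

theorem theorem4:
  fixes G :: "'v graph" and orig :: 'v
  assumes "simple_graph G"
    and "oriented_graph G \<or> unoriented_graph G"
    and "connected_graph G"
    and "bounded_degree G"
    and "orig \<in> verts G"
    and "critical_prob G orig < 1"
  shows "critical_prob (ladder G) (orig, 0) < critical_prob G orig"
proof -
  let ?S = "{p \<in> {0..1::real}. percolation_prob G orig p > 0}"
  have ends: "ends e \<subseteq> verts G" if "e \<in> edges G" for e
    using assms(1) that by (auto simp: simple_graph_def)
  obtain D where D: "\<And>v. v \<in> verts G \<Longrightarrow> finite {e\<in>edges G. v \<in> ends e} \<and> card {e\<in>edges G. v \<in> ends e} \<le> D"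
    using assms(4) by (auto simp: bounded_degree_def)
  \<comment> \<open>Extends the degree bound to all elements of the type, since the exploration
    lemmas quantify over them; elements outside the graph meet no edge.\<close>
  have D': "finite {e\<in>edges G. v \<in> ends e} \<and> card {e\<in>edges G. v \<in> ends e} \<le> D" for v
  proof (cases "v \<in> verts G")
    case False
    then have "{e\<in>edges G. v \<in> ends e} = {}" using ends by auto
    then show ?thesis by (simp only: finite.emptyI card.empty le0 simp_thms)
  qed (rule D)
  have deg: "finite (exits (edges G) v) \<and> card (exits (edges G) v) \<le> D" for v
    using D'[of v] exits_subset[of "edges G" v] by (meson card_mono finite_subset order_trans)
  have countV: "countable (verts G)"
    using D' by (intro countable_connected_graph[OF assms(3,5)]) auto
  have countE: "countable (edges G)" using assms(1) countV by (rule countable_edges_simple_graph)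
  have low: "1 \<le> real D * p" if "p \<in> ?S" for p
    using that percolation_prob_pos_imp[OF countE _ _ deg] by auto
  obtain q0 where q0: "q0 \<in> ?S" "ereal q0 < 1"
    using assms(6) unfolding critical_prob_def Inf_less_iff by auto
  then have "D > 0" using low[of q0] by (cases D) auto
  have "ereal (1 / D) \<le> critical_prob G orig"
    unfolding critical_prob_def
  proof (rule Inf_greatest)
    fix z assume "z \<in> ereal ` ?S"
    then obtain p where "z = ereal p" "p \<in> ?S" by blast
    then show "ereal (1 / D) \<le> z" using low[of p] \<open>D > 0\<close> by (simp add: field_simps)
  qed
  \<comment> \<open>The lower bound \<open>1 / D\<close> and the upper bound 1 make the extended
    real critical value a real number.\<close>
  then obtain c where c: "critical_prob G orig = ereal c" "1 / D \<le> c" "c < 1"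
    using assms(6) by (cases "critical_prob G orig") (auto simp: one_ereal_def)
  then have "0 < c" using \<open>D > 0\<close> by (smt (verit) divide_pos_pos of_nat_0_less_iff)
  \<comment> \<open>The largest density in \<open>G\<close> that the comparison allows against the
    ladder at \<open>p\<close>.\<close>
  define \<psi> :: "real \<Rightarrow> real" where "\<psi> p = p + p\<^sup>2 * (1 - p) ^ Suc D" for p
  have "c < \<psi> c" using \<open>0 < c\<close> c by (simp add: \<psi>_def)
  moreover have "(\<psi> \<longlongrightarrow> \<psi> c) (at_left c)"
    unfolding \<psi>_def by (intro tendsto_intros)
  ultimately have "eventually (\<lambda>p. c < \<psi> p) (at_left c)" by (auto dest: order_tendstoD)
  moreover have "eventually (\<lambda>p. p \<in> {0<..<c}) (at_left c)"
    using \<open>0 < c\<close> by (rule eventually_at_left_real)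
  ultimately have "eventually (\<lambda>p. c < \<psi> p \<and> p \<in> {0<..<c}) (at_left c)"
    by (rule eventually_conj)
  then obtain p where p: "c < \<psi> p" "0 < p" "p < c"
    by (auto dest!: eventually_happens)
  \<comment> \<open>Since \<open>\<psi> p\<close> exceeds the infimum, some percolating density
    \<open>q\<close> of \<open>G\<close> lies below it, although \<open>p\<close> itself is below
    \<open>c\<close>.\<close>
  have "critical_prob G orig < ereal (\<psi> p)" using c p by simp
  then obtain q where q: "q \<in> ?S" "q < \<psi> p"
    unfolding critical_prob_def Inf_less_iff by auto
  have "percolation_prob G orig q \<le> percolation_prob (ladder G) (orig, 0) p"
    using p q c by (intro percolation_prob_le_ladder[OF _ _ _ _ _ countV countE assms(5) ends deg])
      (auto simp: \<psi>_def)
  then have "p \<in> {p \<in> {0..1}. percolation_prob (ladder G) (orig, 0) p > 0}"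
    using q p c by auto
  then have "critical_prob (ladder G) (orig, 0) \<le> ereal p"
    unfolding critical_prob_def by (intro Inf_lower imageI)
  then show ?thesis using c p by (simp add: order_le_less_trans)
qed

end
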